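(* Let $\Delta$ be a pure simplicial complex of dimension $d-1$ on $[n]$. Then $$I(\Delta^{(k)})^\vee=(I(\Delta)^\vee)^{\langle d-k\rangle}\quad\text{for all } k\in\{0,\ldots,d-1\}$$ if and only if $B(\Delta)$ is standard graded.
   Context: Let $K$ be a field, $[n]=\{1,\ldots,n\}$ and $S=K[x_1,\ldots,x_n]$. A simplicial complex on $[n]$ is a nonempty collection of subsets (faces) of $[n]$ closed under taking subsets; facets are maximal faces, $\dim F=|F|-1$, $\dim\Delta$ is the maximal dimension of a face, and $\Delta$ is pure if all facets have the same dimension. The $i$-skeleton $\Delta^{(i)}$ is the simplicial complex of all faces $F\in\Delta$ with $\dim F\le i$. For $F\subseteq [n]$ put $x_F=\prod_{i\in F}x_i$ and let $P_F$ be the ideal generated by the $x_i$, $i\in F$. The facet ideal is $I(\Delta)=(x_F : F \text{ a facet of }\Delta)$, and its Alexander dual is $I(\Delta)^\vee=\bigcap_{F\text{ facet of }\Delta}P_F$ (the same notation is applied to $\Delta^{(k)}$). For a monomial ideal $I$, $I^{\langle k\rangle}$ denotes the ideal generated by all squarefree monomials in $I^k$. For $k\ge 0$, a $k$-cover of $\Delta$ is a nonzero vector $c\in\mathbb{Z}_{\ge 0}^n$ with $\sum_{i\in F}c_i\ge k$ for every facet $F$; it is squarefree if all $c_i\le 1$. Write $x^c=x_1^{c_1}\cdots x_n^{c_n}$. $B(\Delta)\subseteq S[t]$ is the $S$-subalgebra generated by all $x^ct^k$ with $k\geq 1$ and $c$ a squarefree $k$-cover of $\Delta$. It is graded by the degree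 in $t$ (so $S$ is in degree $0$), and it is standard graded if it is generated as an $S$-algebra by its elements of degree $1$. *)

theory Defs
  imports "HOL-Library.Poly_Mapping" "HOL-Computational_Algebra.Polynomial"
begin

section \<open>Ideals of a commutative ring\<close>

text \<open>An ideal is a submodule of the ring viewed as a module over itself.\<close>

lemma module_self: "module ((*) :: 'a::comm_ring_1 \<Rightarrow> 'a \<Rightarrow> 'a)"
  by unfold_locales (simp_all add: algebra_simps)

definition ideal_gen :: "'a::comm_ring_1 set \<Rightarrow> 'a set" where
  "ideal_gen B = module.span (*) B"

definition ideal_mult :: "'a::comm_ring_1 set \<Rightarrow> 'a set \<Rightarrow> 'a set" where
  "ideal_mult I J = ideal_gen {a * b |a b. a \<in> I \<and> b \<in> J}"

primrec ideal_power :: "'a::comm_ring_1 set \<Rightarrow> nat \<Rightarrow> 'a set" where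
  "ideal_power I 0 = UNIV"
| "ideal_power I (Suc k) = ideal_mult I (ideal_power I k)"


section \<open>The polynomial ring and its monomials\<close>

text \<open>
  The index set of the variables, which is also the vertex set of the complexes,
  is a finite type \<^typ>\<open>'n\<close> in place of the set of integers from 1 to n. A polynomial maps
  exponent vectors to coefficients, with finite support.
\<close>

type_synonym ('n, 'k) mpolynomial = "('n \<Rightarrow>\<^sub>0 nat) \<Rightarrow>\<^sub>0 'k"

definition var :: "'n \<Rightarrow> ('n, 'k::field) mpolynomial" where
  "var i = Poly_Mapping.single (Poly_Mapping.single i 1) 1"

definition monom_of_set :: "'n set \<Rightarrow> ('n::finite, 'k::field) mpolynomial" where
  "monom_of_set F = (\<Prod>i\<in>F. var i)"

definition monom_of_exp :: "('n \<Rightarrow> nat) \<Rightarrow> ('n::finite, 'k::field) mpolynomial" where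
  "monom_of_exp c = (\<Prod>i\<in>UNIV. var i ^ c i)"

definition face_ideal :: "'n set \<Rightarrow> ('n::finite, 'k::field) mpolynomial set" where
  "face_ideal F = ideal_gen (var ` F)"

text \<open>The squarefree monomials are exactly the \<^term>\<open>monom_of_set F\<close>, including 1 for the empty set.\<close>

definition squarefree_power ::
  "('n::finite, 'k::field) mpolynomial set \<Rightarrow> nat \<Rightarrow> ('n, 'k) mpolynomial set" where
  "squarefree_power I k = ideal_gen (ideal_power I k \<inter> range monom_of_set)"


section \<open>Simplicial complexes\<close>

definition simplicial_complex :: "'n::finite set set \<Rightarrow> bool" where
  "simplicial_complex \<Delta> \<longleftrightarrow> \<Delta> \<noteq> {} \<and> (\<forall>F\<in>\<Delta>. \<forall>G\<subseteq>F. G \<in> \<Delta>)"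

definition facets :: "'n set set \<Rightarrow> 'n set set" where
  "facets \<Delta> = {F \<in> \<Delta>. \<forall>G\<in>\<Delta>. F \<subseteq> G \<longrightarrow> G = F}"

definition face_dim :: "'n set \<Rightarrow> int" where
  "face_dim F = int (card F) - 1"

definition complex_dim :: "'n::finite set set \<Rightarrow> int" where
  "complex_dim \<Delta> = Max (face_dim ` \<Delta>)"

definition pure :: "'n set set \<Rightarrow> bool" where
  "pure \<Delta> \<longleftrightarrow> (\<forall>F\<in>facets \<Delta>. \<forall>G\<in>facets \<Delta>. face_dim F = face_dim G)"

definition skeleton :: "int \<Rightarrow> 'n set set \<Rightarrow> 'n set set" where
  "skeleton i \<Delta> = {F \<in> \<Delta>. face_dim F \<le> i}"

definition facet_ideal :: "'n set set \<Rightarrow> ('n::finite, 'k::field) mpolynomial set" where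
  "facet_ideal \<Delta> = ideal_gen (monom_of_set ` facets \<Delta>)"

text \<open>The Alexander dual of \<^term>\<open>facet_ideal \<Delta>\<close>.\<close>

definition facet_ideal_dual :: "'n set set \<Rightarrow> ('n::finite, 'k::field) mpolynomial set" where
  "facet_ideal_dual \<Delta> = (\<Inter>F\<in>facets \<Delta>. face_ideal F)"


section \<open>Vertex covers and the algebra they generate\<close>

definition is_cover :: "'n set set \<Rightarrow> nat \<Rightarrow> ('n \<Rightarrow> nat) \<Rightarrow> bool" where
  "is_cover \<Delta> k c \<longleftrightarrow> c \<noteq> (\<lambda>_. 0) \<and> (\<forall>F\<in>facets \<Delta>. k \<le> (\<Sum>i\<in>F. c i))"

definition squarefree_vec :: "('n \<Rightarrow> nat) \<Rightarrow> bool" where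
  "squarefree_vec c \<longleftrightarrow> (\<forall>i. c i \<le> 1)"

text \<open>
  For a commutative ring R of type \<^typ>\<open>'a\<close>, the type \<^typ>\<open>'a poly\<close> is R[t], with R embedded
  as the constant polynomials, and \<^term>\<open>monom a k\<close> is a times the k-th power of t.
\<close>

definition is_subalgebra :: "'a::comm_ring_1 poly set \<Rightarrow> bool" where
  "is_subalgebra A \<longleftrightarrow> (\<forall>a. [:a:] \<in> A) \<and> (\<forall>p\<in>A. \<forall>q\<in>A. p + q \<in> A \<and> p * q \<in> A)"

definition subalgebra_gen :: "'a::comm_ring_1 poly set \<Rightarrow> 'a poly set" where
  "subalgebra_gen X = is_subalgebra hull X"

definition squarefree_cover_algebra ::
  "'n set set \<Rightarrow> ('n::finite, 'k::field) mpolynomial poly set" where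
  "squarefree_cover_algebra \<Delta> =
     subalgebra_gen {monom (monom_of_exp c) k |c k. k \<ge> 1 \<and> is_cover \<Delta> k c \<and> squarefree_vec c}"

text \<open>The homogeneous elements of degree 1 in R[t] are the multiples a t with a in R.\<close>

definition standard_graded :: "'a::comm_ring_1 poly set \<Rightarrow> bool" where
  "standard_graded A \<longleftrightarrow> A = subalgebra_gen (A \<inter> {monom a 1 |a. True})"

end

theory Submission
  imports Defs "HOL-Library.Indicator_Function"
begin

text \<open>
  Both conditions say the same thing about vertex covers: for all \<open>m \<ge> 1\<close>, every squarefree
  \<open>m\<close>-cover is a sum of \<open>m\<close> \<open>1\<close>-covers. This is \<open>squarefree_covers_split\<close>.

  All ideals in question are spanned over the field by monomials, so they are determined by their
  sets of exponents, and products of such ideals correspond to sums of exponent sets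
  (\<open>ideal_mult_spanned\<close>). The Alexander dual \<open>I\<close> of the facet ideal is spanned by the monomials whose
  exponents are \<open>1\<close>-covers, so the \<open>m\<close>-th squarefree power of \<open>I\<close> is generated by those
  \<open>x_C\<close> for which the indicator of \<open>C\<close> is a sum of \<open>m\<close> \<open>1\<close>-covers.

  For the skeletons, let all facets have \<open>d\<close> elements and let \<open>k < d\<close>. The facets of the
  \<open>k\<close>-skeleton are the faces with \<open>k + 1\<close> elements, that is, the subsets of that size of facets
  of \<open>\<Delta>\<close>. A set \<open>C\<close> meets all of them iff no facet \<open>F\<close> has \<open>k + 1\<close> elements outside \<open>C\<close>, and
  thus iff \<open>C\<close> contains at least \<open>d - k\<close> elements of every \<open>F\<close>: the indicator of \<open>C\<close> is a
  \<open>(d - k)\<close>-cover. So the dual ideals of the \<open>k\<close>-skeletons agree with the squarefree powers iff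
  squarefree \<open>m\<close>-covers split for \<open>1 \<le> m \<le> d\<close>; larger \<open>m\<close> have no squarefree \<open>m\<close>-covers at all
  (\<open>skeleton_duals_iff\<close>).

  On the side of the algebra, the component of degree \<open>1\<close> is \<open>I t\<close>, because the support of a
  \<open>1\<close>-cover is again a \<open>1\<close>-cover. The subalgebra generated by it is the Rees algebra of \<open>I\<close>, whose
  component of degree \<open>m\<close> is spanned by the \<open>x^a t^m\<close> with \<open>a\<close> a sum of \<open>m\<close> \<open>1\<close>-covers. The cover
  algebra is standard graded iff this Rees algebra contains each generator \<open>x^c t^m\<close>, that is, iff
  every squarefree \<open>m\<close>-cover \<open>c\<close> splits (\<open>standard_graded_iff\<close>).
\<close>

section \<open>Monomial ideals and exponent sets\<close>

abbreviation mon :: "('n \<Rightarrow>\<^sub>0 nat) \<Rightarrow> ('n, 'k::field) mpolynomial" where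
  "mon a \<equiv> Poly_Mapping.single a 1"

definition spanned :: "('n \<Rightarrow>\<^sub>0 nat) set \<Rightarrow> ('n, 'k::field) mpolynomial set" where
  "spanned U = {p. Poly_Mapping.keys p \<subseteq> U}"

text \<open>Under this condition on \<open>U\<close>, the span of the monomials with exponents in \<open>U\<close> is an ideal.\<close>

definition upset :: "('n \<Rightarrow>\<^sub>0 nat) set \<Rightarrow> bool" where
  "upset U \<longleftrightarrow> (\<forall>u\<in>U. \<forall>v. u + v \<in> U)"

definition sumset :: "'a::plus set \<Rightarrow> 'a set \<Rightarrow> 'a set" where
  "sumset U V = {u + v |u v. u \<in> U \<and> v \<in> V}"

lemma sumsetI: "u \<in> U \<Longrightarrow> v \<in> V \<Longrightarrow> u + v \<in> sumset U V"
  unfolding sumset_def by blast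

text \<open>
  The start value \<^term>\<open>UNIV\<close> mirrors the power of an ideal with exponent 0, which is the whole
  ring; it makes every value upward closed, so that \<open>fold_sumset U m\<close> is the set of exponents of
  the \<open>m\<close>-th power of the ideal spanned by \<open>U\<close>, and a sum of \<open>m\<close> elements of \<open>U\<close> may be enlarged.
\<close>

primrec fold_sumset :: "'a::plus set \<Rightarrow> nat \<Rightarrow> 'a set" where
  "fold_sumset U 0 = UNIV"
| "fold_sumset U (Suc m) = sumset U (fold_sumset U m)"

lemma upset_sumset: "upset V \<Longrightarrow> upset (sumset U V)"
  unfolding upset_def sumset_def by (auto simp: add.assoc) metis

lemma upset_fold_sumset: "upset (fold_sumset U m)"
  by (induction m) (simp add: upset_def, simp add: upset_sumset)

lemma mon_in_spanned [simp]: "(mon a :: ('n, 'k::field) mpolynomial) \<in> spanned U \<longleftrightarrow> a \<in> U"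
  by (simp add: spanned_def)

lemma spanned_eq_iff:
  "(spanned U :: ('n, 'k::field) mpolynomial set) = spanned V \<longleftrightarrow> U = V"
proof
  assume eq: "(spanned U :: ('n, 'k) mpolynomial set) = spanned V"
  have "a \<in> U \<longleftrightarrow> (mon a :: ('n, 'k) mpolynomial) \<in> spanned U" for a by simp
  then show "U = V" unfolding eq by auto
qed simp

lemma spanned_mult: "p \<in> spanned U \<Longrightarrow> q \<in> spanned V \<Longrightarrow> p * q \<in> spanned (sumset U V)"
  unfolding spanned_def sumset_def mem_Collect_eq
  by (rule order_trans[OF keys_mult]) blast

lemma spanned_add: "p \<in> spanned U \<Longrightarrow> q \<in> spanned U \<Longrightarrow> p + q \<in> spanned U"
  unfolding spanned_def using Poly_Mapping.keys_add[of p q] by auto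

lemma zero_in_spanned [simp]: "0 \<in> spanned U"
  by (simp add: spanned_def)

lemma sum_in_spanned: "(\<And>i. i \<in> I \<Longrightarrow> f i \<in> spanned U) \<Longrightarrow> sum f I \<in> spanned U"
  by (induction I rule: infinite_finite_induct) (auto intro: spanned_add)

lemma sumset_commute: "sumset U V = sumset V (U :: 'a::ab_semigroup_add set)"
  unfolding sumset_def by (blast intro: add.commute)

lemma sumset_UNIV_right: "upset U \<Longrightarrow> sumset U UNIV = U"
proof
  assume "upset U"
  then show "sumset U UNIV \<subseteq> U" by (auto simp: sumset_def upset_def)
  show "U \<subseteq> sumset U UNIV"
  proof
    fix u assume "u \<in> U"
    then have "u + 0 \<in> sumset U UNIV" by (intro sumsetI) auto
    then show "u \<in> sumset U UNIV" by simp
  qed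
qed

lemma sumset_UNIV_left: "upset U \<Longrightarrow> sumset UNIV U = U"
  by (subst sumset_commute) (rule sumset_UNIV_right)

lemma fold_sumset_add:
  fixes U :: "('n \<Rightarrow>\<^sub>0 nat) set"
  shows "sumset (fold_sumset U i) (fold_sumset U j) \<subseteq> fold_sumset U (i + j)"
proof (induction i)
  case 0
  then show ?case using upset_fold_sumset[of U j] by (simp add: sumset_UNIV_left)
next
  case (Suc i)
  show ?case
  proof
    fix a assume "a \<in> sumset (fold_sumset U (Suc i)) (fold_sumset U j)"
    then obtain u v w where "u \<in> U" "v \<in> fold_sumset U i" "w \<in> fold_sumset U j" "a = u + (v + w)"
      by (auto simp: sumset_def add.assoc)
    moreover from this have "v + w \<in> fold_sumset U (i + j)" using Suc by (auto simp: sumset_def)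
    ultimately show "a \<in> fold_sumset U (Suc i + j)" by (auto simp: sumset_def)
  qed
qed

lemma subspace_spanned: "upset U \<Longrightarrow> module.subspace (*) (spanned U)"
  using spanned_mult[of _ UNIV _ U]
  by (auto simp: module.subspace_def[OF module_self] spanned_add sumset_UNIV_left)
     (simp add: spanned_def)

text \<open>
  Coefficients are written as constant polynomials, since scalars act on ideals and on subalgebras
  only through multiplication in the ring.
\<close>

lemma mpolynomial_eq_sum:
  fixes p :: "('n, 'k::field) mpolynomial"
  shows "p = (\<Sum>a\<in>Poly_Mapping.keys p. Poly_Mapping.single 0 (Poly_Mapping.lookup p a) * mon a)"
proof (rule poly_mapping_eqI)
  fix b
  show "Poly_Mapping.lookup p b = Poly_Mapping.lookup (\<Sum>a\<in>Poly_Mapping.keys p. Poly_Mapping.single 0 (Poly_Mapping.lookup p a) * mon a) b"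
    by (auto simp: mult_single lookup_sum lookup_single when_def sum.delta in_keys_iff)
qed

lemma spanned_subset_ideal_gen:
  fixes B :: "('n, 'k::field) mpolynomial set"
  assumes "\<And>a. a \<in> U \<Longrightarrow> mon a \<in> ideal_gen B"
  shows "spanned U \<subseteq> ideal_gen B"
proof
  fix p :: "('n, 'k) mpolynomial" assume "p \<in> spanned U"
  then have "(\<Sum>a\<in>Poly_Mapping.keys p. Poly_Mapping.single 0 (Poly_Mapping.lookup p a) * mon a) \<in> ideal_gen B"
    using assms unfolding ideal_gen_def spanned_def
    by (intro module.span_sum[OF module_self] module.span_scale[OF module_self]) auto
  then show "p \<in> ideal_gen B" using mpolynomial_eq_sum[of p] by simp
qed

lemma ideal_gen_minimal:
  "B \<subseteq> spanned U \<Longrightarrow> upset U \<Longrightarrow> ideal_gen B \<subseteq> spanned U"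
  unfolding ideal_gen_def by (intro module.span_minimal[OF module_self] subspace_spanned)

lemma ideal_gen_mons:
  "(ideal_gen (mon ` G) :: ('n, 'k::field) mpolynomial set) = spanned (sumset G UNIV)"
proof
  show "(ideal_gen (mon ` G) :: ('n, 'k) mpolynomial set) \<subseteq> spanned (sumset G UNIV)"
  proof (rule ideal_gen_minimal)
    show "(mon ` G :: ('n, 'k) mpolynomial set) \<subseteq> spanned (sumset G UNIV)"
      using sumsetI[of _ G 0 UNIV] by auto
    show "upset (sumset G UNIV)" by (rule upset_sumset) (simp add: upset_def)
  qed
  show "(spanned (sumset G UNIV) :: ('n, 'k) mpolynomial set) \<subseteq> ideal_gen (mon ` G)"
  proof (rule spanned_subset_ideal_gen)
    fix a assume "a \<in> sumset G UNIV"
    then obtain g b where "g \<in> G" "a = g + b" by (auto simp: sumset_def)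
    then have "(mon a :: ('n, 'k) mpolynomial) = mon b * mon g"
      by (simp add: mult_single add.commute)
    then show "(mon a :: ('n, 'k) mpolynomial) \<in> ideal_gen (mon ` G)"
      using \<open>g \<in> G\<close> unfolding ideal_gen_def
      by (metis module.span_scale[OF module_self] module.span_base[OF module_self] imageI)
  qed
qed

lemma ideal_mult_spanned:
  assumes "upset V"
  shows "ideal_mult (spanned U) (spanned V :: ('n, 'k::field) mpolynomial set)
    = spanned (sumset U V)"
proof
  show "ideal_mult (spanned U) (spanned V :: ('n, 'k) mpolynomial set) \<subseteq> spanned (sumset U V)"
    unfolding ideal_mult_def
    by (rule ideal_gen_minimal) (auto intro: spanned_mult upset_sumset assms)
  show "(spanned (sumset U V) :: ('n, 'k) mpolynomial set) \<subseteq> ideal_mult (spanned U) (spanned V)"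
    unfolding ideal_mult_def
  proof (rule spanned_subset_ideal_gen)
    fix a assume "a \<in> sumset U V"
    then obtain u v where uv: "u \<in> U" "v \<in> V" "a = u + v" by (auto simp: sumset_def)
    then have "(mon a :: ('n, 'k) mpolynomial) = mon u * mon v"
      by (simp add: mult_single)
    then show "(mon a :: ('n, 'k) mpolynomial) \<in>
        ideal_gen {a * b |a b. a \<in> spanned U \<and> b \<in> spanned V}"
      using uv unfolding ideal_gen_def
      by (intro module.span_base[OF module_self]) (auto intro!: exI[of _ "mon _"])
  qed
qed

lemma ideal_power_spanned: "ideal_power (spanned U) m = spanned (fold_sumset U m)"
  by (induction m) (auto simp: ideal_mult_spanned upset_fold_sumset, simp add: spanned_def)

section \<open>Squarefree exponents\<close>

definition expo :: "('n::finite \<Rightarrow> nat) \<Rightarrow> 'n \<Rightarrow>\<^sub>0 nat" where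
  "expo c = Abs_poly_mapping c"

definition ind :: "'n::finite set \<Rightarrow> 'n \<Rightarrow>\<^sub>0 nat" where
  "ind C = expo (indicator C)"

lemma lookup_expo [simp]: "Poly_Mapping.lookup (expo c) = c"
  by (simp add: expo_def)

lemma lookup_ind [simp]: "Poly_Mapping.lookup (ind C) = indicator C"
  by (simp add: ind_def)

lemma keys_ind [simp]: "Poly_Mapping.keys (ind C) = C"
  by (auto simp: in_keys_iff indicator_def)

lemma mon_add: "mon (a + b) = mon a * mon b"
  by (simp add: mult_single)

lemma prod_mon: "finite I \<Longrightarrow> (\<Prod>i\<in>I. mon (f i)) = mon (sum f I)"
  by (induction I rule: finite_induct) (simp_all add: mon_add)

lemma monom_of_set_eq: "monom_of_set C = mon (ind C)"
proof -
  have "(\<Sum>i\<in>C. Poly_Mapping.single i 1) = ind C"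
    by (rule poly_mapping_eqI)
       (auto simp: lookup_sum lookup_single when_def indicator_def sum.delta)
  then show ?thesis unfolding monom_of_set_def var_def by (simp add: prod_mon)
qed

lemma power_var: "var i ^ m = mon (Poly_Mapping.single i m)"
  by (induction m) (simp_all add: var_def mult_single single_add[symmetric])

lemma monom_of_exp_eq: "monom_of_exp c = mon (expo c)"
proof -
  have "(\<Sum>i\<in>UNIV. Poly_Mapping.single i (c i)) = expo c"
    by (rule poly_mapping_eqI)
       (auto simp: lookup_sum lookup_single when_def sum.delta)
  then show ?thesis unfolding monom_of_exp_def by (simp add: power_var prod_mon)
qed

text \<open>
  The monomial \<open>x_C\<close> divides \<open>x^a\<close> iff \<open>C\<close> lies in the support of \<open>a\<close>. So membership of a
  monomial in an ideal generated by squarefree monomials depends only on its support.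
\<close>

lemma mult_of_ind_iff:
  "a \<in> sumset (ind ` \<C>) UNIV \<longleftrightarrow> (\<exists>C\<in>\<C>. C \<subseteq> Poly_Mapping.keys a)"
proof
  assume "a \<in> sumset (ind ` \<C>) UNIV"
  then obtain C b where "C \<in> \<C>" and a: "a = ind C + b" by (auto simp: sumset_def)
  moreover have "C \<subseteq> Poly_Mapping.keys a" by (auto simp: a in_keys_iff lookup_add)
  ultimately show "\<exists>C\<in>\<C>. C \<subseteq> Poly_Mapping.keys a" by blast
next
  assume "\<exists>C\<in>\<C>. C \<subseteq> Poly_Mapping.keys a"
  then obtain C where C: "C \<in> \<C>" "C \<subseteq> Poly_Mapping.keys a" by auto
  have "a = ind C + (a - ind C)"
    using C(2) by (intro poly_mapping_eqI)
      (auto simp: lookup_add lookup_minus indicator_def in_keys_iff Suc_le_eq dest!: subsetD)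
  with C(1) show "a \<in> sumset (ind ` \<C>) UNIV" unfolding sumset_def by blast
qed

lemma face_ideal_eq:
  "(face_ideal F :: ('n::finite, 'k::field) mpolynomial set) = spanned {a. F \<inter> Poly_Mapping.keys a \<noteq> {}}"
proof -
  have "Poly_Mapping.single i 1 = ind {i}" for i :: 'n
    by (rule poly_mapping_eqI) (auto simp: lookup_single when_def indicator_def)
  then have "(var ` F :: ('n, 'k) mpolynomial set) = mon ` ind ` (\<lambda>i. {i}) ` F"
    unfolding var_def by (simp add: image_image)
  moreover have "sumset (ind ` (\<lambda>i. {i}) ` F) UNIV = {a. F \<inter> Poly_Mapping.keys a \<noteq> {}}"
    by (auto simp: mult_of_ind_iff)
  ultimately show ?thesis by (simp add: face_ideal_def ideal_gen_mons)
qed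

lemma facet_ideal_dual_eq:
  "facet_ideal_dual \<Delta> = spanned {a. \<forall>F\<in>facets \<Delta>. F \<inter> Poly_Mapping.keys a \<noteq> {}}"
  unfolding facet_ideal_dual_def face_ideal_eq by (auto simp: spanned_def)

lemma squarefree_power_spanned:
  "(squarefree_power (spanned U) m :: ('n::finite, 'k::field) mpolynomial set)
    = spanned {a. \<exists>C. ind C \<in> fold_sumset U m \<and> C \<subseteq> Poly_Mapping.keys a}"
proof -
  have "(ideal_power (spanned U) m \<inter> range monom_of_set :: ('n, 'k) mpolynomial set)
      = mon ` ind ` {C. ind C \<in> fold_sumset U m}"
    by (auto simp: ideal_power_spanned monom_of_set_eq)
  moreover have "sumset (ind ` {C. ind C \<in> fold_sumset U m}) UNIV
      = {a. \<exists>C. ind C \<in> fold_sumset U m \<and> C \<subseteq> Poly_Mapping.keys a}"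
    by (auto simp: mult_of_ind_iff)
  ultimately show ?thesis by (simp add: squarefree_power_def ideal_gen_mons)
qed

section \<open>Covers\<close>

definition covers :: "'n::finite set set \<Rightarrow> nat \<Rightarrow> ('n \<Rightarrow>\<^sub>0 nat) set" where
  "covers \<Delta> m = {a. \<forall>F\<in>facets \<Delta>. m \<le> (\<Sum>i\<in>F. Poly_Mapping.lookup a i)}"

lemma covers_0 [simp]: "covers \<Delta> 0 = UNIV"
  by (simp add: covers_def)

text \<open>
  Thus the spans of the \<open>m\<close>-covers, for all \<open>m\<close>, are the components of a graded algebra, and the
  cover algebra lies inside it.
\<close>

lemma sumset_covers: "sumset (covers \<Delta> l) (covers \<Delta> m) \<subseteq> covers \<Delta> (l + m)"
proof
  fix a assume "a \<in> sumset (covers \<Delta> l) (covers \<Delta> m)"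
  then obtain u v where uv: "u \<in> covers \<Delta> l" "v \<in> covers \<Delta> m" "a = u + v"
    by (auto simp: sumset_def)
  show "a \<in> covers \<Delta> (l + m)"
    unfolding covers_def
  proof (intro CollectI ballI)
    fix F assume "F \<in> facets \<Delta>"
    then have "l + m \<le> (\<Sum>i\<in>F. Poly_Mapping.lookup u i) + (\<Sum>i\<in>F. Poly_Mapping.lookup v i)"
      using uv(1,2) by (intro add_mono) (simp_all add: covers_def)
    then show "l + m \<le> (\<Sum>i\<in>F. Poly_Mapping.lookup a i)"
      by (simp add: uv(3) lookup_add sum.distrib)
  qed
qed

lemma upset_covers: "upset (covers \<Delta> m)"
  using sumset_covers[of \<Delta> m 0] unfolding upset_def sumset_def by fastforce

lemma fold_sumset_covers: "fold_sumset (covers \<Delta> 1) m \<subseteq> covers \<Delta> m"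
proof (induction m)
  case (Suc m)
  then have "sumset (covers \<Delta> 1) (fold_sumset (covers \<Delta> 1) m)
      \<subseteq> sumset (covers \<Delta> 1) (covers \<Delta> m)"
    by (auto simp: sumset_def)
  also have "\<dots> \<subseteq> covers \<Delta> (Suc m)" using sumset_covers[of \<Delta> 1 m] by simp
  finally show ?case by simp
qed simp

lemma ind_in_covers_iff: "ind C \<in> covers \<Delta> m \<longleftrightarrow> (\<forall>F\<in>facets \<Delta>. m \<le> card (F \<inter> C))"
  by (simp add: covers_def indicator_def sum.If_cases)

lemma covers_1_iff: "a \<in> covers \<Delta> 1 \<longleftrightarrow> (\<forall>F\<in>facets \<Delta>. F \<inter> Poly_Mapping.keys a \<noteq> {})"
proof -
  have "1 \<le> (\<Sum>i\<in>F. Poly_Mapping.lookup a i) \<longleftrightarrow> F \<inter> Poly_Mapping.keys a \<noteq> {}" for F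
    by (auto simp: Suc_le_eq in_keys_iff simp flip: neq0_conv)
  then show ?thesis by (simp add: covers_def)
qed

text \<open>
  A \<open>1\<close>-cover is a vector whose support meets every facet, which is the condition for its monomial
  to lie in all the face ideals.
\<close>

lemma facet_ideal_dual_covers: "facet_ideal_dual \<Delta> = spanned (covers \<Delta> 1)"
  unfolding facet_ideal_dual_eq covers_1_iff[symmetric] by simp

lemma ind_keys_decomp: "a = ind (Poly_Mapping.keys a) + (a - ind (Poly_Mapping.keys a))"
  by (rule poly_mapping_eqI) (auto simp: lookup_add lookup_minus indicator_def in_keys_iff)

text \<open>
  The combinatorial condition to which both sides of the theorem reduce. The case \<open>m = 0\<close> is
  trivially true.
\<close>

definition squarefree_covers_split :: "'n::finite set set \<Rightarrow> bool" where
  "squarefree_covers_split \<Delta> \<longleftrightarrow>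
    (\<forall>m C. ind C \<in> covers \<Delta> m \<longrightarrow> ind C \<in> fold_sumset (covers \<Delta> 1) m)"

section \<open>Pure complexes and skeletons\<close>

lemma face_subset_facet:
  assumes "F \<in> \<Delta>"
  obtains G where "G \<in> facets \<Delta>" "F \<subseteq> (G :: 'n::finite set)"
  using finite_has_maximal2[of \<Delta> F] assms unfolding facets_def by auto

lemma card_facet:
  assumes "simplicial_complex \<Delta>" "pure \<Delta>" "complex_dim \<Delta> = int d - 1"
  shows "\<forall>F\<in>facets \<Delta>. card F = d"
proof
  fix F assume F: "F \<in> facets \<Delta>"
  have fin: "finite (face_dim ` \<Delta>)" and ne: "face_dim ` \<Delta> \<noteq> {}"
    using assms(1) by (auto simp: simplicial_complex_def)
  obtain H where H: "H \<in> \<Delta>" "face_dim H = int d - 1"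
    using Max_in[OF fin ne] assms(3) unfolding complex_dim_def by auto
  obtain G where G: "G \<in> facets \<Delta>" "H \<subseteq> G" using face_subset_facet[OF H(1)] .
  have "face_dim H \<le> face_dim G" using G(2) card_mono[OF finite, of H G] by (simp add: face_dim_def)
  moreover have "face_dim G \<le> int d - 1"
    using Max_ge[OF fin, of "face_dim G"] G(1) assms(3)
    unfolding complex_dim_def facets_def by auto
  moreover have "face_dim F = face_dim G" using assms(2) F G(1) unfolding pure_def by blast
  ultimately show "card F = d" using H(2) by (simp add: face_dim_def)
qed

text \<open>
  A face with fewer than \<open>k + 1\<close> elements is not maximal in the skeleton: it lies in a facet of
  \<open>\<Delta>\<close>, which is large enough to extend it to \<open>k + 1\<close> elements.
\<close>

lemma facets_skeleton:
  assumes "simplicial_complex \<Delta>" "\<forall>F\<in>facets \<Delta>. card F = d" "k < d"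
  shows "facets (skeleton (int k) \<Delta>) = {G. card G = Suc k \<and> (\<exists>F\<in>facets \<Delta>. G \<subseteq> F)}"
proof (intro equalityI subsetI)
  fix G assume "G \<in> facets (skeleton (int k) \<Delta>)"
  then have G: "G \<in> \<Delta>" "card G \<le> Suc k"
    and max: "\<And>H. H \<in> \<Delta> \<Longrightarrow> card H \<le> Suc k \<Longrightarrow> G \<subseteq> H \<Longrightarrow> H = G"
    by (auto simp: facets_def skeleton_def face_dim_def)
  obtain F where F: "F \<in> facets \<Delta>" "G \<subseteq> F" using face_subset_facet[OF G(1)] .
  obtain H where H: "G \<subseteq> H" "H \<subseteq> F" "card H = Suc k"
    using exists_subset_between[of G "Suc k" F] G(2) F bspec[OF assms(2) F(1)] assms(3) by auto
  have "H \<in> \<Delta>" using F(1) H(2) assms(1) by (auto simp: facets_def simplicial_complex_def)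
  then have "H = G" using max H by auto
  then show "G \<in> {G. card G = Suc k \<and> (\<exists>F\<in>facets \<Delta>. G \<subseteq> F)}" using F H by auto
next
  fix G assume "G \<in> {G. card G = Suc k \<and> (\<exists>F\<in>facets \<Delta>. G \<subseteq> F)}"
  then have G: "card G = Suc k" "G \<in> \<Delta>"
    using assms(1) by (auto simp: facets_def simplicial_complex_def)
  have "H = G" if "card H \<le> Suc k" "G \<subseteq> H" for H
    using card_seteq[of H G] that G(1) by auto
  then show "G \<in> facets (skeleton (int k) \<Delta>)"
    using G by (auto simp: facets_def skeleton_def face_dim_def)
qed

text \<open>
  A set \<open>C\<close> misses some \<open>(k + 1)\<close>-subset of a facet \<open>F\<close> iff \<open>F - C\<close> has at least \<open>k + 1\<close>
  elements, and thus iff \<open>F \<inter> C\<close> has fewer than \<open>d - k\<close> elements.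
\<close>

lemma facet_ideal_dual_skeleton:
  assumes "simplicial_complex \<Delta>" "\<forall>F\<in>facets \<Delta>. card F = d" "k < d"
  shows "facet_ideal_dual (skeleton (int k) \<Delta>)
    = spanned {a. ind (Poly_Mapping.keys a) \<in> covers \<Delta> (d - k)}"
proof -
  have "(\<forall>G\<in>facets (skeleton (int k) \<Delta>). G \<inter> C \<noteq> {}) \<longleftrightarrow> (\<forall>F\<in>facets \<Delta>. d - k \<le> card (F \<inter> C))"
    (is "?L \<longleftrightarrow> ?R") for C
  proof
    assume L: ?L
    show ?R
    proof (intro ballI)
      fix F assume F: "F \<in> facets \<Delta>"
      have split: "card F = card (F \<inter> C) + card (F - C)"
        by (rule card_Int_Diff) simp
      have "\<not> Suc k \<le> card (F - C)"
      proof
        assume "Suc k \<le> card (F - C)"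
        then obtain G where "G \<subseteq> F - C" "card G = Suc k"
          by (metis obtain_subset_with_card_n)
        then show False using L F unfolding facets_skeleton[OF assms] by blast
      qed
      then show "d - k \<le> card (F \<inter> C)" using split bspec[OF assms(2) F] by linarith
    qed
  next
    assume R: ?R
    show ?L
    proof (intro ballI notI)
      fix G assume "G \<in> facets (skeleton (int k) \<Delta>)" and disj: "G \<inter> C = {}"
      then obtain F where F: "F \<in> facets \<Delta>" "G \<subseteq> F" and G: "card G = Suc k"
        unfolding facets_skeleton[OF assms] by blast
      have "card (F \<inter> C) + card G \<le> card F"
        using disj F(2) by (subst card_Un_disjoint[symmetric]) (auto intro!: card_mono)
      moreover have "d - k \<le> card (F \<inter> C)" using R F(1) by blast
      ultimately show False using G bspec[OF assms(2) F(1)] assms(3) by linarith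
    qed
  qed
  then show ?thesis by (simp add: facet_ideal_dual_eq ind_in_covers_iff)
qed

text \<open>
  Sums of \<open>m\<close> \<open>1\<close>-covers are always \<open>m\<close>-covers, so one inclusion of the ideals is automatic, and
  equality for \<open>k = d - m\<close> says that all squarefree \<open>m\<close>-covers split.
\<close>

lemma skeleton_duals_iff:
  fixes \<Delta> :: "'n::finite set set"
  assumes "simplicial_complex \<Delta>" "\<forall>F\<in>facets \<Delta>. card F = d"
  shows "(\<forall>k<d. (facet_ideal_dual (skeleton (int k) \<Delta>) :: ('n, 'k::field) mpolynomial set)
                 = squarefree_power (facet_ideal_dual \<Delta>) (d - k))
     \<longleftrightarrow> squarefree_covers_split \<Delta>"
proof -
  let ?D = "fold_sumset (covers \<Delta> 1)"
  \<comment> \<open>The supports that lie above a splitting set are exactly the splitting sets, because a sum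
    of covers may be enlarged by the missing elements.\<close>
  have down: "(\<exists>C. ind C \<in> ?D m \<and> C \<subseteq> K) \<longleftrightarrow> ind K \<in> ?D m" for m K
  proof
    assume "\<exists>C. ind C \<in> ?D m \<and> C \<subseteq> K"
    then obtain C where C: "ind C \<in> ?D m" "C \<subseteq> K" by blast
    have "ind K = ind C + ind (K - C)"
      using C(2) by (intro poly_mapping_eqI) (auto simp: lookup_add indicator_def)
    then show "ind K \<in> ?D m" using C(1) upset_fold_sumset[of "covers \<Delta> 1" m] by (simp add: upset_def)
  qed auto
  have "(facet_ideal_dual (skeleton (int k) \<Delta>) :: ('n, 'k) mpolynomial set)
        = squarefree_power (facet_ideal_dual \<Delta>) (d - k)
      \<longleftrightarrow> (\<forall>C. ind C \<in> covers \<Delta> (d - k) \<longrightarrow> ind C \<in> ?D (d - k))" if "k < d" for k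
  proof -
    have "(facet_ideal_dual (skeleton (int k) \<Delta>) :: ('n, 'k) mpolynomial set)
        = squarefree_power (facet_ideal_dual \<Delta>) (d - k)
      \<longleftrightarrow> (\<forall>a :: 'n \<Rightarrow>\<^sub>0 nat. ind (Poly_Mapping.keys a) \<in> covers \<Delta> (d - k)
              \<longleftrightarrow> ind (Poly_Mapping.keys a) \<in> ?D (d - k))"
      unfolding facet_ideal_dual_skeleton[OF assms that] facet_ideal_dual_covers[of \<Delta>]
        squarefree_power_spanned down spanned_eq_iff by (simp add: set_eq_iff)
    also have "\<dots> \<longleftrightarrow> (\<forall>C. ind C \<in> covers \<Delta> (d - k) \<longleftrightarrow> ind C \<in> ?D (d - k))"
      by (metis keys_ind)
    finally show ?thesis using fold_sumset_covers[of \<Delta> "d - k"] by blast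
  qed
  then have "(\<forall>k<d. (facet_ideal_dual (skeleton (int k) \<Delta>) :: ('n, 'k) mpolynomial set)
        = squarefree_power (facet_ideal_dual \<Delta>) (d - k))
      \<longleftrightarrow> (\<forall>k<d. \<forall>C. ind C \<in> covers \<Delta> (d - k) \<longrightarrow> ind C \<in> ?D (d - k))" by blast
  also have "\<dots> \<longleftrightarrow> squarefree_covers_split \<Delta>"
    unfolding squarefree_covers_split_def
  proof (intro iffI allI impI)
    fix m C
    assume H: "\<forall>k<d. \<forall>C. ind C \<in> covers \<Delta> (d - k) \<longrightarrow> ind C \<in> ?D (d - k)"
      and C: "ind C \<in> covers \<Delta> m"
    \<comment> \<open>There is a facet, and a squarefree vector has sum at most \<open>d\<close> on it.\<close>
    obtain H0 where "H0 \<in> \<Delta>" using assms(1) by (auto simp: simplicial_complex_def)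
    then obtain F where F: "F \<in> facets \<Delta>" using face_subset_facet by metis
    have "m \<le> card (F \<inter> C)" using C F by (simp add: ind_in_covers_iff)
    also have "\<dots> \<le> d" using bspec[OF assms(2) F] card_mono[of F "F \<inter> C"] by simp
    finally have "m \<le> d" .
    show "ind C \<in> ?D m"
    proof (cases "m = 0")
      case False
      then show ?thesis using H[rule_format, of "d - m" C] C \<open>m \<le> d\<close> by simp
    qed simp
  qed auto
  finally show ?thesis .
qed

section \<open>The cover algebra\<close>

definition graded_spanned ::
  "(nat \<Rightarrow> ('n \<Rightarrow>\<^sub>0 nat) set) \<Rightarrow> ('n, 'k::field) mpolynomial poly set" where
  "graded_spanned W = {p. \<forall>k. coeff p k \<in> spanned (W k)}"

lemma monom_mon_in_graded_spanned [simp]: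
  "monom (mon a :: ('n, 'k::field) mpolynomial) k \<in> graded_spanned W \<longleftrightarrow> a \<in> W k"
  by (auto simp: graded_spanned_def)

lemma is_subalgebra_graded_spanned:
  fixes W :: "nat \<Rightarrow> ('n \<Rightarrow>\<^sub>0 nat) set"
  assumes "W 0 = UNIV" "\<And>i j. sumset (W i) (W j) \<subseteq> W (i + j)"
  shows "is_subalgebra (graded_spanned W :: ('n, 'k::field) mpolynomial poly set)"
  unfolding is_subalgebra_def
proof (intro conjI allI ballI)
  fix a :: "('n, 'k) mpolynomial"
  show "[:a:] \<in> graded_spanned W"
    using assms(1) by (auto simp: graded_spanned_def coeff_pCons spanned_def split: nat.split)
next
  fix p q :: "('n, 'k) mpolynomial poly"
  assume pq: "p \<in> graded_spanned W" "q \<in> graded_spanned W"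
  then show "p + q \<in> graded_spanned W" by (auto simp: graded_spanned_def intro: spanned_add)
  have "(\<Sum>i\<le>k. coeff p i * coeff q (k - i)) \<in> spanned (W k)" for k
  proof (rule sum_in_spanned)
    fix i assume "i \<in> {..k}"
    then have "sumset (W i) (W (k - i)) \<subseteq> W k" using assms(2)[of i "k - i"] by simp
    moreover have "coeff p i * coeff q (k - i) \<in> spanned (sumset (W i) (W (k - i)))"
      using pq by (intro spanned_mult) (auto simp: graded_spanned_def)
    ultimately show "coeff p i * coeff q (k - i) \<in> spanned (W k)"
      by (auto simp: spanned_def)
  qed
  then show "p * q \<in> graded_spanned W" by (simp add: graded_spanned_def coeff_mult)
qed

lemma is_subalgebra_subalgebra_gen: "is_subalgebra (subalgebra_gen X)"
  unfolding subalgebra_gen_def by (rule hull_in) (auto simp: is_subalgebra_def)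

lemma subalgebra_gen_base: "X \<subseteq> subalgebra_gen X"
  unfolding subalgebra_gen_def by (rule hull_subset)

lemma subalgebra_gen_minimal: "X \<subseteq> A \<Longrightarrow> is_subalgebra A \<Longrightarrow> subalgebra_gen X \<subseteq> A"
  unfolding subalgebra_gen_def by (rule hull_minimal)

lemma is_subalgebra_smult: "is_subalgebra A \<Longrightarrow> p \<in> A \<Longrightarrow> smult a p \<in> A"
proof -
  assume "is_subalgebra A" "p \<in> A"
  then have "[:a:] * p \<in> A" unfolding is_subalgebra_def by blast
  then show "smult a p \<in> A" by simp
qed

lemma is_subalgebra_sum:
  assumes "is_subalgebra A" "\<And>i. i \<in> I \<Longrightarrow> f i \<in> A"
  shows "sum f I \<in> A"
proof -
  have "0 \<in> A" using assms(1) by (metis is_subalgebra_def pCons_0_0)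
  then show ?thesis using assms
    by (induction I rule: infinite_finite_induct) (auto simp: is_subalgebra_def)
qed

lemma graded_spanned_subset:
  fixes A :: "('n, 'k::field) mpolynomial poly set"
  assumes A: "is_subalgebra A" and mon: "\<And>k a. a \<in> W k \<Longrightarrow> monom (mon a) k \<in> A"
  shows "graded_spanned W \<subseteq> A"
proof
  fix p :: "('n, 'k) mpolynomial poly" assume p: "p \<in> graded_spanned W"
  have "monom (coeff p k) k \<in> A" for k
  proof -
    let ?q = "coeff p k"
    have "smult (Poly_Mapping.single 0 (Poly_Mapping.lookup ?q a)) (monom (mon a) k) \<in> A"
      if "a \<in> Poly_Mapping.keys ?q" for a
      using p that by (intro is_subalgebra_smult[OF A] mon) (auto simp: graded_spanned_def spanned_def)
    then have "(\<Sum>a\<in>Poly_Mapping.keys ?q.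
        smult (Poly_Mapping.single 0 (Poly_Mapping.lookup ?q a)) (monom (mon a) k)) \<in> A"
      by (rule is_subalgebra_sum[OF A])
    also have "(\<Sum>a\<in>Poly_Mapping.keys ?q.
        smult (Poly_Mapping.single 0 (Poly_Mapping.lookup ?q a)) (monom (mon a) k))
        = monom (\<Sum>a\<in>Poly_Mapping.keys ?q. Poly_Mapping.single 0 (Poly_Mapping.lookup ?q a) * mon a) k"
      by (simp add: smult_monom monom_sum)
    finally show ?thesis using mpolynomial_eq_sum[of ?q] by simp
  qed
  then have "(\<Sum>k\<le>degree p. monom (coeff p k) k) \<in> A" by (intro is_subalgebra_sum[OF A])
  then show "p \<in> A" by (simp add: poly_as_sum_of_monoms)
qed

text \<open>
  This is the description of the Rees algebra of a monomial ideal: its component of degree \<open>k\<close> is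
  the \<open>k\<close>-th power of the ideal, since \<open>x^(u + v) t^(k + 1)\<close> is the product of \<open>x^u t\<close> and \<open>x^v t^k\<close>.
\<close>

lemma subalgebra_gen_degree_one:
  fixes U :: "('n \<Rightarrow>\<^sub>0 nat) set"
  assumes "upset U"
  shows "(subalgebra_gen {monom p 1 |p. p \<in> spanned U} :: ('n, 'k::field) mpolynomial poly set)
    = graded_spanned (fold_sumset U)"
proof
  let ?X = "{monom p 1 |p. p \<in> spanned U} :: ('n, 'k) mpolynomial poly set"
  have "fold_sumset U 1 = U" by (simp add: sumset_UNIV_right assms)
  then have "?X \<subseteq> graded_spanned (fold_sumset U)"
    by (auto simp: graded_spanned_def coeff_monom)
  then show "subalgebra_gen ?X \<subseteq> graded_spanned (fold_sumset U)"
    by (rule subalgebra_gen_minimal) (intro is_subalgebra_graded_spanned fold_sumset_add, simp)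
  have "monom (mon a) k \<in> subalgebra_gen ?X" if "a \<in> fold_sumset U k" for k a
    using that
  proof (induction k arbitrary: a)
    case 0
    then show ?case using is_subalgebra_subalgebra_gen[of ?X]
      by (simp add: is_subalgebra_def monom_0)
  next
    case (Suc k)
    then obtain u v where uv: "u \<in> U" "v \<in> fold_sumset U k" "a = u + v" by (auto simp: sumset_def)
    have "(mon u :: ('n, 'k) mpolynomial) \<in> spanned U" using uv(1) by simp
    then have "monom (mon u) 1 \<in> ?X" by blast
    then have "monom (mon u) 1 \<in> subalgebra_gen ?X" by (rule subsetD[OF subalgebra_gen_base])
    then have "monom (mon u) 1 * monom (mon v) k \<in> subalgebra_gen ?X"
      using Suc.IH[OF uv(2)] is_subalgebra_subalgebra_gen[of ?X] by (simp add: is_subalgebra_def)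
    then show ?case by (simp add: uv(3) mult_monom mon_add)
  qed
  then show "graded_spanned (fold_sumset U) \<subseteq> subalgebra_gen ?X"
    by (intro graded_spanned_subset is_subalgebra_subalgebra_gen)
qed

text \<open>
  There is a facet, and so a vector with sum at least \<open>k \<ge> 1\<close> on every facet is nonzero. Hence the
  squarefree \<open>k\<close>-covers are the indicator vectors in \<open>covers \<Delta> k\<close>.
\<close>

lemma squarefree_cover_algebra_eq:
  fixes \<Delta> :: "'n::finite set set"
  assumes "simplicial_complex \<Delta>"
  shows "squarefree_cover_algebra \<Delta> = (subalgebra_gen
    {monom (mon (ind C)) k |C k. k \<ge> 1 \<and> ind C \<in> covers \<Delta> k} :: ('n, 'k::field) mpolynomial poly set)"
proof -
  obtain H where "H \<in> \<Delta>" using assms by (auto simp: simplicial_complex_def)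
  then obtain F where F: "F \<in> facets \<Delta>" using face_subset_facet by metis
  have cover: "is_cover \<Delta> k c \<longleftrightarrow> expo c \<in> covers \<Delta> k" if "k \<ge> 1" for k c
    using that F by (auto simp: is_cover_def covers_def)
  have sqf: "squarefree_vec c \<longleftrightarrow> (\<exists>C. expo c = ind C)" for c :: "'n \<Rightarrow> nat"
  proof
    assume c: "squarefree_vec c"
    have "expo c = ind {i. c i = 1}"
      using c by (intro poly_mapping_eqI) (force simp: squarefree_vec_def indicator_def le_Suc_eq)
    then show "\<exists>C. expo c = ind C" ..
  next
    assume "\<exists>C. expo c = ind C"
    then have "\<exists>C. c = indicator C" by (metis lookup_expo lookup_ind)
    then show "squarefree_vec c" by (auto simp: squarefree_vec_def indicator_def)
  qed
  have "{monom (monom_of_exp c) k |c k. k \<ge> 1 \<and> is_cover \<Delta> k c \<and> squarefree_vec c}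
      = {monom (mon (ind C) :: ('n, 'k) mpolynomial) k |C k. k \<ge> 1 \<and> ind C \<in> covers \<Delta> k}"
    (is "?L = ?R")
  proof
    show "?L \<subseteq> ?R"
    proof
      fix q assume "q \<in> ?L"
      then obtain c k where q: "q = monom (mon (expo c)) k" "k \<ge> 1" "is_cover \<Delta> k c" "squarefree_vec c"
        unfolding monom_of_exp_eq by blast
      from q(4) obtain C where C: "expo c = ind C" unfolding sqf by blast
      from q(3) have "ind C \<in> covers \<Delta> k" unfolding cover[OF q(2)] C .
      with q(1,2) show "q \<in> ?R" unfolding C by blast
    qed
    show "?R \<subseteq> ?L"
    proof
      fix q assume "q \<in> ?R"
      then obtain C k where q: "q = monom (mon (ind C)) k" "k \<ge> 1" "ind C \<in> covers \<Delta> k" by blast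
      then have "is_cover \<Delta> k (indicator C)" "squarefree_vec (indicator C)"
        unfolding cover[OF q(2)] sqf ind_def by auto
      with q(1,2) show "q \<in> ?L" unfolding monom_of_exp_eq ind_def by blast
    qed
  qed
  then show ?thesis by (simp add: squarefree_cover_algebra_def)
qed

text \<open>
  The component of degree 1 of the cover algebra generates a Rees algebra inside the cover algebra.
  They coincide iff the Rees algebra contains the generators of the cover algebra.
\<close>

lemma standard_graded_iff:
  fixes \<Delta> :: "'n::finite set set"
  assumes "simplicial_complex \<Delta>"
  shows "standard_graded (squarefree_cover_algebra \<Delta> :: ('n, 'k::field) mpolynomial poly set)
     \<longleftrightarrow> squarefree_covers_split \<Delta>"
proof -
  let ?gens = "{monom (mon (ind C)) k |C k. k \<ge> 1 \<and> ind C \<in> covers \<Delta> k}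
    :: ('n, 'k) mpolynomial poly set"
  let ?A = "subalgebra_gen ?gens"
  let ?N = "graded_spanned (fold_sumset (covers \<Delta> 1)) :: ('n, 'k) mpolynomial poly set"
  have A: "is_subalgebra ?A" by (rule is_subalgebra_subalgebra_gen)
  have N: "is_subalgebra ?N" by (intro is_subalgebra_graded_spanned fold_sumset_add) simp
  have upper: "?A \<subseteq> graded_spanned (covers \<Delta>)"
    by (rule subalgebra_gen_minimal) (auto intro!: is_subalgebra_graded_spanned sumset_covers)
  have deg1: "?A \<inter> {monom a 1 |a. True} = {monom p 1 |p. p \<in> spanned (covers \<Delta> 1)}"
  proof
    show "?A \<inter> {monom a 1 |a. True} \<subseteq> {monom p 1 |p. p \<in> spanned (covers \<Delta> 1)}"
    proof
      fix q assume q: "q \<in> ?A \<inter> {monom a 1 |a. True}"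
      from q[THEN IntD2] obtain p where p: "q = monom p 1" by blast
      from q[THEN IntD1] upper have "q \<in> graded_spanned (covers \<Delta>)" by (rule rev_subsetD)
      then have "coeff (monom p 1) 1 \<in> spanned (covers \<Delta> 1)"
        unfolding p graded_spanned_def by blast
      then have "p \<in> spanned (covers \<Delta> 1)" by simp
      with p show "q \<in> {monom p 1 |p. p \<in> spanned (covers \<Delta> 1)}" by blast
    qed
  next
    have "monom (mon a) 1 \<in> ?A" if "a \<in> covers \<Delta> 1" for a
    proof -
      \<comment> \<open>The support of \<open>a\<close> is a squarefree \<open>1\<close>-cover, and \<open>x^a t\<close> is a multiple of the generator belonging to it.\<close>
      let ?C = "Poly_Mapping.keys a"
      have "ind ?C \<in> covers \<Delta> 1"
        using that unfolding covers_1_iff keys_ind .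
      then have "monom (mon (ind ?C)) 1 \<in> ?gens" by blast
      then have "monom (mon (ind ?C)) 1 \<in> ?A" by (rule subsetD[OF subalgebra_gen_base])
      then have "smult (mon (a - ind ?C)) (monom (mon (ind ?C)) 1) \<in> ?A"
        by (rule is_subalgebra_smult[OF A])
      moreover have "mon (a - ind ?C) * mon (ind ?C) = (mon a :: ('n, 'k) mpolynomial)"
        using ind_keys_decomp[of a] by (simp add: mult_single add.commute)
      ultimately show ?thesis by (simp add: smult_monom)
    qed
    \<comment> \<open>The family concentrated in degree 1 carries this from monomials over to their span.\<close>
    then have "graded_spanned (\<lambda>k. if k = 1 then covers \<Delta> 1 else {}) \<subseteq> ?A"
      by (intro graded_spanned_subset[OF A]) (auto split: if_splits)
    moreover have "monom p 1 \<in> graded_spanned (\<lambda>k. if k = 1 then covers \<Delta> 1 else {})"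
      if "p \<in> spanned (covers \<Delta> 1)" for p :: "('n, 'k) mpolynomial"
      using that by (simp add: graded_spanned_def coeff_monom)
    ultimately show "{monom p 1 |p. p \<in> spanned (covers \<Delta> 1)} \<subseteq> ?A \<inter> {monom a 1 |a. True}"
      by blast
  qed
  have gen1: "subalgebra_gen (?A \<inter> {monom a 1 |a. True}) = ?N"
    unfolding deg1 by (rule subalgebra_gen_degree_one[OF upset_covers])
  have "?N \<subseteq> ?A" unfolding gen1[symmetric] by (rule subalgebra_gen_minimal[OF _ A]) blast
  then have "standard_graded ?A \<longleftrightarrow> ?A \<subseteq> ?N"
    unfolding standard_graded_def gen1 by blast
  also have "\<dots> \<longleftrightarrow> ?gens \<subseteq> ?N"
    using subalgebra_gen_base[of ?gens] subalgebra_gen_minimal[OF _ N, of ?gens] by blast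
  also have "\<dots> \<longleftrightarrow> (\<forall>C. \<forall>k\<ge>1. ind C \<in> covers \<Delta> k \<longrightarrow> ind C \<in> fold_sumset (covers \<Delta> 1) k)"
  proof -
    have "monom (mon (ind C) :: ('n, 'k) mpolynomial) k \<in> ?N
        \<longleftrightarrow> ind C \<in> fold_sumset (covers \<Delta> 1) k" for C k
      by (rule monom_mon_in_graded_spanned)
    then show ?thesis by blast
  qed
  also have "\<dots> \<longleftrightarrow> squarefree_covers_split \<Delta>"
    unfolding squarefree_covers_split_def
  proof -
    have "k \<ge> 1" if "ind C \<notin> fold_sumset (covers \<Delta> 1) k" for C k
      using that by (cases k) auto
    then show "(\<forall>C. \<forall>k\<ge>1. ind C \<in> covers \<Delta> k \<longrightarrow> ind C \<in> fold_sumset (covers \<Delta> 1) k)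
      \<longleftrightarrow> (\<forall>m C. ind C \<in> covers \<Delta> m \<longrightarrow> ind C \<in> fold_sumset (covers \<Delta> 1) m)"
      by blast
  qed
  finally show ?thesis by (simp add: squarefree_cover_algebra_eq[OF assms])
qed

theorem corollary1p3:
  fixes \<Delta> :: "'n::finite set set" and d :: nat
  assumes "simplicial_complex \<Delta>"
    and "pure \<Delta>"
    and "complex_dim \<Delta> = int d - 1"
  shows "(\<forall>k<d. (facet_ideal_dual (skeleton (int k) \<Delta>) :: ('n, 'k::field) mpolynomial set)
                 = squarefree_power (facet_ideal_dual \<Delta>) (d - k))
     \<longleftrightarrow> standard_graded (squarefree_cover_algebra \<Delta> :: ('n, 'k) mpolynomial poly set)"
  using skeleton_duals_iff[OF assms(1) card_facet[OF assms], where ?'k = 'k]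
    standard_graded_iff[OF assms(1), where ?'k = 'k] by simp

end
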